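(* Let $\lambda\in\mathbb{R}$ and let $k\ge1$ be an integer. Then we have the generating function $$\frac{1}{1-1\otimes x^{\otimes k}}=\sum_{n=0}^{\infty}(1\otimes x^{\otimes k})^n=\sum_{n=0}^{\infty}\ \sum_{I\in\pi(kn)}C_I\,\lambda^{kn-\ell(I)}\,(1\otimes x^{\otimes I})\ \in\ \widehat{\mathrm{Sh}}_\lambda(x).$$
   Context: Let $A=\mathbb{R}[x]$ and $\mathrm{Sh}_\lambda(x)=\bigoplus_{k\ge1}A^{\otimes k}$ (tensor products over $\mathbb{R}$), the free commutative Rota–Baxter algebra of weight $\lambda$ on one generator $x$, with $\mathbb{R}$-basis the words $x^{n_0}\otimes x^{n_1}\otimes\cdots\otimes x^{n_k}$ ($k\ge0$, $n_i\ge0$). Its commutative product is given bilinearly by $(a_0\otimes a)(b_0\otimes b)=a_0b_0\otimes(a*b)$, where $a_0,b_0\in A$, $a=a_1\otimes\cdots\otimes a_m$, $b=b_1\otimes\cdots\otimes b_n$ ($m,n\ge0$, $a_i,b_j\in A$) and $*$ is the mixable shuffle (stuffle) product of weight $\lambda$: the empty tensor is the unit for $*$, and $$(a_1\otimes a')*(b_1\otimes b')=a_1\otimes\big(a'*(b_1\otimes b')\big)+b_1\otimes\big((a_1\otimes a')*b'\big)+\lambda\,a_1b_1\otimes(a'*b').$$ The unit is $1\in A$. The submodules $\mathrm{Fil}^j=\bigoplus_{i\ge j}A^{\otimes i}$ are ideals of $\mathrm{Sh}_\lambda(x)$, and $\widehat{\mathrm{Sh}}_\lambda(x)=\varprojlim_j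 \mathrm{Sh}_\lambda(x)/\mathrm{Fil}^j\cong\prod_{i\ge1}A^{\otimes i}$ is the corresponding complete filtered algebra (the complete free commutative Rota–Baxter algebra on $x$), which contains $\mathrm{Sh}_\lambda(x)$ as a subalgebra. $1\otimes x^{\otimes k}$ is $1\otimes x\otimes\cdots\otimes x$ with $k$ factors $x$. For a tuple $I=(i_1,\dots,i_t)$ of positive integers, $1\otimes x^{\otimes I}=1\otimes x^{i_1}\otimes\cdots\otimes x^{i_t}$ and $\ell(I)=t$. For $n\ge1$, $\pi(kn)$ is the set of compositions $I=(i_1,\dots,i_t)$ of $kn$ (ordered tuples of positive integers with sum $kn$) with every part $i_j\le n$. For such $I$, $C_I=C_{n,k,I}$ is the number of restricted partitions of type $I$ of the multiset $S=\{1^k,2^k,\dots,n^k\}$, i.e. the number of ordered tuples $(B_1,\dots,B_t)$ of subsets of $[n]=\{1,\dots,n\}$ with $\#B_j=i_j$ for $1\le j\le t$ and such that each element of $[n]$ lies in exactly $k$ of the sets $B_j$. For $n=0$, $\pi(0)$ consists of the empty composition $I=\emptyset$, with $C_\emptyset=1$, $\ell(\emptyset)=kn=0$ and $1\otimes x^{\otimes\emptyset}=1$. Convention: $\lambda^0=1$ (also for $\lambda=0$).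
   Formalization: For λ≠0 the sum is not in the stated completion (infinitely many words of equal tensor length), so the identity is proved for all λ in the completion by tensor length and x-degree, termwise in Sh_λ(x), and in the stated completion for λ=0. *)

theory Defs
  imports Complex_Main "HOL-Algebra.Module"
begin

section \<open>Words and the mixable shuffle (stuffle) product\<close>

text \<open>
  The pair \<open>(n0, [n1, \<dots>, nk])\<close> stands for the basis word
  \<open>x^n0 \<otimes> x^n1 \<otimes> \<dots> \<otimes> x^nk\<close> of \<open>A^{\<otimes>(k+1)}\<close>, where \<open>A = \<real>[x]\<close>.  A (possibly infinite)
  real linear combination of words is represented by its coefficient function.
\<close>

type_synonym tword = "nat \<times> nat list"

definition tensor_len :: "tword \<Rightarrow> nat" where
  "tensor_len p = Suc (length (snd p))"

definition x_degree :: "tword \<Rightarrow> nat" where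
  "x_degree p = fst p + sum_list (snd p)"

text \<open>\<open>prepend a f\<close> is \<open>x^a \<otimes> f\<close>, extended linearly.\<close>

definition prepend :: "nat \<Rightarrow> (nat list \<Rightarrow> real) \<Rightarrow> nat list \<Rightarrow> real" where
  "prepend a f w = (case w of [] \<Rightarrow> 0 | c # w' \<Rightarrow> if c = a then f w' else 0)"

text \<open>
  \<open>stuffle lam u v w\<close> is the coefficient of the (possibly empty) word \<open>w\<close> in \<open>u * v\<close>; it is given on
  basis words, where \<open>x^a x^b = x^(a+b)\<close>, and determines \<open>*\<close> by bilinearity.
\<close>

fun stuffle :: "real \<Rightarrow> nat list \<Rightarrow> nat list \<Rightarrow> nat list \<Rightarrow> real" where
  "stuffle lam [] v w = (if w = v then 1 else 0)"
| "stuffle lam (a # u) [] w = (if w = a # u then 1 else 0)"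
| "stuffle lam (a # u) (b # v) w =
     prepend a (stuffle lam u (b # v)) w
     + prepend b (stuffle lam (a # u) v) w
     + lam * prepend (a + b) (stuffle lam u v) w"

lemma stuffle_nonzero:
  "stuffle lam u v w \<noteq> 0 \<Longrightarrow>
     sum_list w = sum_list u + sum_list v \<and> length u \<le> length w \<and> length v \<le> length w"
proof (induction lam u v w rule: stuffle.induct)
  case (3 lam a u b v w)
  show ?case
  proof (cases w)
    case Nil
    with 3 show ?thesis by (simp add: prepend_def)
  next
    case (Cons c w')
    have "(c = a \<and> stuffle lam u (b # v) w' \<noteq> 0) \<or> (c = b \<and> stuffle lam (a # u) v w' \<noteq> 0)
        \<or> (c = a + b \<and> stuffle lam u v w' \<noteq> 0)"
    proof (rule ccontr)
      assume "\<not> ?thesis"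
      then have "stuffle lam (a # u) (b # v) w = 0"
        unfolding Cons stuffle.simps by (auto simp: prepend_def)
      with 3(4) show False by simp
    qed
    then consider
      "c = a" "stuffle lam u (b # v) w' \<noteq> 0" | "c = b" "stuffle lam (a # u) v w' \<noteq> 0"
      | "c = a + b" "stuffle lam u v w' \<noteq> 0"
      by blast
    then show ?thesis
      using 3(1-3)[of w'] Cons by cases auto
  qed
qed (auto split: if_splits)

section \<open>The algebras\<close>

text \<open>
  Coefficient of the word \<open>(c, w)\<close> in \<open>f \<cdot> g\<close>, from
  \<open>(a \<otimes> u)(b \<otimes> v) = ab \<otimes> (u * v)\<close>.  Only finitely many pairs of words contribute
  (\<open>finite_contributing\<close>), so this extends the product from finite linear combinations to arbitrary
  coefficient functions.
\<close>

definition contributing :: "real \<Rightarrow> tword \<Rightarrow> (tword \<times> tword) set" where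
  "contributing lam r =
     {(p, q). fst p + fst q = fst r \<and> stuffle lam (snd p) (snd q) (snd r) \<noteq> 0}"

definition word_mult :: "real \<Rightarrow> (tword \<Rightarrow> real) \<Rightarrow> (tword \<Rightarrow> real) \<Rightarrow> tword \<Rightarrow> real" where
  "word_mult lam f g r =
     (\<Sum>(p, q)\<in>contributing lam r. f p * g q * stuffle lam (snd p) (snd q) (snd r))"

lemma finite_contributing: "finite (contributing lam r)"
proof -
  define L where "L = {us :: nat list. set us \<subseteq> {..sum_list (snd r)} \<and> length us \<le> length (snd r)}"
  have "finite L"
    unfolding L_def by (rule finite_lists_length_le) simp
  moreover have "contributing lam r \<subseteq> ({..fst r} \<times> L) \<times> ({..fst r} \<times> L)"
  proof (intro subsetI)
    fix x
    assume "x \<in> contributing lam r"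
    then obtain a u b v where x: "x = ((a, u), (b, v))"
      and *: "a + b = fst r" "stuffle lam u v (snd r) \<noteq> 0"
      by (cases x) (auto simp: contributing_def)
    note ** = stuffle_nonzero[OF *(2)]
    have "y \<le> sum_list us" if "y \<in> set us" for y and us :: "nat list"
      using that by (simp add: member_le_sum_list)
    then have "u \<in> L" "v \<in> L"
      using ** unfolding L_def by fastforce+
    with x * show "x \<in> ({..fst r} \<times> L) \<times> ({..fst r} \<times> L)" by auto
  qed
  ultimately show ?thesis
    by (meson finite_SigmaI finite_atMost finite_subset)
qed

definition of_word :: "tword \<Rightarrow> tword \<Rightarrow> real" where
  "of_word p = (\<lambda>q. if q = p then 1 else 0)"

definition word_algebra :: "real \<Rightarrow> (tword \<Rightarrow> real) set \<Rightarrow> (real, tword \<Rightarrow> real) module" where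
  "word_algebra lam M =
     \<lparr>carrier = M, mult = word_mult lam, one = of_word (0, []),
      zero = (\<lambda>_. 0), add = (\<lambda>f g p. f p + g p), smult = (\<lambda>c f p. c * f p)\<rparr>"

text \<open>\<open>Sh lam\<close> is the direct sum of the \<open>A^{\<otimes>k}\<close>, \<open>k \<ge> 1\<close>.\<close>

definition Sh :: "real \<Rightarrow> (real, tword \<Rightarrow> real) module" where
  "Sh lam = word_algebra lam {f. finite {p. f p \<noteq> 0}}"

text \<open>\<open>hatSh lam\<close> is \<open>\<Prod>_{i\<ge>1} A^{\<otimes>i}\<close>: in each fixed tensor length the support is finite.\<close>

definition hatSh :: "real \<Rightarrow> (real, tword \<Rightarrow> real) module" where
  "hatSh lam = word_algebra lam {f. \<forall>i. finite {p. tensor_len p = i \<and> f p \<noteq> 0}}"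

text \<open>
  If \<open>lam \<noteq> 0\<close> then \<open>1 - 1 \<otimes> x^{\<otimes>k}\<close> is not invertible in \<open>hatSh lam\<close>: for \<open>k = 1\<close>, the component
  in \<open>A \<otimes> A\<close> of its inverse would have to be \<open>\<Sum>_{n\<ge>1} lam^(n-1) (1 \<otimes> x^n)\<close>, which is not a finite
  sum.  The generating function therefore needs the completion of \<open>Sh lam\<close> at the
  tensor length and at the degree in \<open>x\<close>, that is
  \<open>lim_j Sh/(Fil^j + D^j)\<close> with \<open>D^j\<close> the ideal spanned by the words of degree at least \<open>j\<close>.
  It consists of all coefficient functions and contains both
  \<open>Sh lam\<close> and \<open>hatSh lam\<close> as subalgebras.
\<close>

definition bihatSh :: "real \<Rightarrow> (real, tword \<Rightarrow> real) module" where
  "bihatSh lam = word_algebra lam UNIV"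

definition hatFil :: "nat \<Rightarrow> (tword \<Rightarrow> real) set" where
  "hatFil j = {f. \<forall>p. tensor_len p < j \<longrightarrow> f p = 0}"

text \<open>The completion of \<open>Fil^j + D^j\<close>.\<close>

definition bihatFil :: "nat \<Rightarrow> (tword \<Rightarrow> real) set" where
  "bihatFil j = {f. \<forall>p. tensor_len p < j \<and> x_degree p < j \<longrightarrow> f p = 0}"

text \<open>Convergence of the series \<open>s 0 + s 1 + \<dots>\<close> to \<open>S\<close> in the topology of a filtration \<open>F\<close>.\<close>

definition series_sums ::
    "('a, 'b, 'm) module_scheme \<Rightarrow> (nat \<Rightarrow> 'b set) \<Rightarrow> (nat \<Rightarrow> 'b) \<Rightarrow> 'b \<Rightarrow> bool" where
  "series_sums R F s S \<longleftrightarrow>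
     (\<forall>j. \<forall>\<^sub>F N in sequentially. (\<Oplus>\<^bsub>R\<^esub>n\<in>{..<N}. s n) \<ominus>\<^bsub>R\<^esub> S \<in> F j)"

section \<open>The terms of the generating function\<close>

definition one_tensor :: "nat list \<Rightarrow> tword \<Rightarrow> real" where
  "one_tensor I = of_word (0, I)"

definition one_tensor_x :: "nat \<Rightarrow> tword \<Rightarrow> real" where
  "one_tensor_x k = one_tensor (replicate k 1)"

text \<open>\<open>bounded_compositions n k\<close> is \<open>\<pi>(kn)\<close>; the bound on the parts is \<open>n\<close>.\<close>

definition bounded_compositions :: "nat \<Rightarrow> nat \<Rightarrow> nat list set" where
  "bounded_compositions n k = {I. sum_list I = k * n \<and> (\<forall>i\<in>set I. 1 \<le> i \<and> i \<le> n)}"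

definition restricted_partitions :: "nat \<Rightarrow> nat \<Rightarrow> nat list \<Rightarrow> nat set list set" where
  "restricted_partitions n k I =
     {B. length B = length I
         \<and> (\<forall>j<length I. B ! j \<subseteq> {1..n} \<and> card (B ! j) = I ! j)
         \<and> (\<forall>e\<in>{1..n}. card {j. j < length I \<and> e \<in> B ! j} = k)}"

definition C_coeff :: "nat \<Rightarrow> nat \<Rightarrow> nat list \<Rightarrow> nat" where
  "C_coeff n k I = card (restricted_partitions n k I)"

definition composition_sum ::
    "(real, tword \<Rightarrow> real) module \<Rightarrow> real \<Rightarrow> nat \<Rightarrow> nat \<Rightarrow> tword \<Rightarrow> real" where
  "composition_sum R lam k n =
     (\<Oplus>\<^bsub>R\<^esub>I\<in>bounded_compositions n k.
        (real (C_coeff n k I) * lam ^ (k * n - length I)) \<odot>\<^bsub>R\<^esub> one_tensor I)"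

end

theory Submission
  imports Defs
begin

text \<open>
  Multiplying \<open>1 \<otimes> x^{\<otimes>I}\<close> by \<open>1 \<otimes> x^{\<otimes>k}\<close> either inserts a letter \<open>x\<close> or, at the price of a
  factor \<open>\<lambda>\<close>, multiplies a letter of \<open>I\<close> by \<open>x\<close>, altogether in \<open>k\<close> different positions of the
  resulting word.  These are the ways to distribute \<open>k\<close> copies of the new element \<open>n+1\<close> over the
  blocks of a restricted partition, so the coefficients of \<open>(1 \<otimes> x^{\<otimes>k})^n\<close> follow by induction
  on \<open>n\<close>.

  Multiplication by \<open>1 \<otimes> x^{\<otimes>k}\<close> raises the degree in \<open>x\<close>, so the geometric series is locally
  finite; this also makes inverses of \<open>1 - 1 \<otimes> x^{\<otimes>k}\<close> unique without using associativity of
  the product.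
\<close>

section \<open>Restricted partitions\<close>

text \<open>A pattern marks the \<open>k\<close> positions of a word of length \<open>l\<close> at
  which the new factor contributes a letter \<open>x\<close>, inserted or merged. In terms of
  blocks, it marks those containing the new element.\<close>

definition patterns :: "nat \<Rightarrow> nat \<Rightarrow> bool list set" where
  "patterns k l = {t. length t = l \<and> length (filter id t) = k}"

text \<open>Undoes one multiplication along a pattern: a marked letter loses one \<open>x\<close>,
  and a marked letter 1, which may have been inserted, disappears. In terms of blocks,
  \<open>n+1\<close> is removed and the blocks left empty are dropped.\<close>

definition strip :: "bool list \<Rightarrow> nat list \<Rightarrow> nat list" where
  "strip t J = filter (\<lambda>i. i \<noteq> 0) (map2 (\<lambda>b i. if b then i - 1 else i) t J)"

lemma finite_patterns: "finite (patterns k l)"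
  by (rule finite_subset[OF _ finite_lists_length_eq[of "UNIV :: bool set" l]])
    (auto simp: patterns_def)

lemma patterns_0: "patterns k 0 = (if k = 0 then {[]} else {})"
  by (auto simp: patterns_def)

lemma patterns_Suc:
  "patterns k (Suc l) =
     (#) False ` patterns k l \<union> (if k = 0 then {} else (#) True ` patterns (k - 1) l)"
proof -
  have "t \<in> patterns k (Suc l) \<longleftrightarrow>
     t \<in> (#) False ` patterns k l \<union> (if k = 0 then {} else (#) True ` patterns (k - 1) l)" for t
    by (cases t; cases "hd t"; cases k) (auto simp: patterns_def)
  then show ?thesis by blast
qed

lemma sum_patterns_Suc:
  "(\<Sum>t\<in>patterns k (Suc l). g t) =
     (\<Sum>t\<in>patterns k l. g (False # t)) +
     (if k = 0 then 0 else (\<Sum>t\<in>patterns (k - 1) l. g (True # t)))"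
  for g :: "bool list \<Rightarrow> 'a::comm_monoid_add"
proof -
  have "(\<Sum>t\<in>patterns k (Suc l). g t) =
     sum g ((#) False ` patterns k l) + sum g (if k = 0 then {} else (#) True ` patterns (k - 1) l)"
    unfolding patterns_Suc by (rule sum.union_disjoint) (auto simp: finite_patterns)
  then show ?thesis by (simp add: sum.reindex)
qed

lemma strip_Cons:
  "strip (b # t) (c # J) =
     (if (if b then c - 1 else c) = 0 then strip t J else (if b then c - 1 else c) # strip t J)"
  by (simp add: strip_def)

lemma strip_Nil [simp]: "strip t [] = []"
  by (simp add: strip_def)

lemma zero_notin_strip: "0 \<notin> set (strip t J)"
  by (simp add: strip_def)

text \<open>Only a marked letter can become 0 and disappear. Hence the truncated difference
  \<open>k + length (strip t J) - length J\<close> is a true one; it counts the merged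
  letters.\<close>

lemma length_le_strip:
  "t \<in> patterns k (length J) \<Longrightarrow> 0 \<notin> set J \<Longrightarrow> length J \<le> k + length (strip t J)"
proof (induction J arbitrary: t k)
  case Nil
  then show ?case by simp
next
  case (Cons c J)
  then obtain b t' where t: "t = b # t'" by (cases t) (auto simp: patterns_def)
  have *: "t' \<in> patterns (if b then k - 1 else k) (length J)" "b \<Longrightarrow> k > 0"
    using Cons.prems(1) unfolding t by (auto simp: patterns_def)
  then show ?case
    using Cons.IH[OF *(1)] Cons.prems(2) unfolding t strip_Cons by (auto split: if_splits)
qed

text \<open>Replaces indices by \<open>map\<close>, \<open>set\<close> and \<open>filter\<close>, so
  that induction over the list of blocks applies.\<close>

lemma restricted_partitions_alt:
  "restricted_partitions n k I =
     {B. map card B = I \<and> set B \<subseteq> Pow {1..n} \<and> (\<forall>e\<in>{1..n}. length (filter (\<lambda>S. e \<in> S) B) = k)}"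
proof -
  have "B \<in> restricted_partitions n k I \<longleftrightarrow> map card B = I \<and> set B \<subseteq> Pow {1..n}
      \<and> (\<forall>e\<in>{1..n}. length (filter (\<lambda>S. e \<in> S) B) = k)" for B
  proof (cases "length B = length I")
    case True
    have "(\<forall>j<length I. B ! j \<subseteq> {1..n} \<and> card (B ! j) = I ! j) \<longleftrightarrow>
       map card B = I \<and> set B \<subseteq> Pow {1..n}"
      using True by (auto simp: list_eq_iff_nth_eq in_set_conv_nth subset_eq Ball_def)
    then show ?thesis
      using True by (auto simp: restricted_partitions_def length_filter_conv_card)
  qed (auto simp: restricted_partitions_def)
  then show ?thesis by blast
qed

lemma finite_restricted_partitions: "finite (restricted_partitions n k I)"
proof (rule finite_subset)
  show "restricted_partitions n k I \<subseteq> {B. set B \<subseteq> Pow {1..n} \<and> length B = length I}"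
    unfolding restricted_partitions_alt by auto
qed (rule finite_lists_length_eq, simp)

text \<open>Double counting of the incidences between elements and blocks.\<close>

lemma sum_list_map_card:
  "set B \<subseteq> Pow {1..n} \<Longrightarrow> sum_list (map card B) = (\<Sum>e\<in>{1..n}. length (filter (\<lambda>S. e \<in> S) B))"
  for n :: nat
proof (induction B)
  case Nil
  then show ?case by simp
next
  case (Cons S B)
  have "card S = (\<Sum>e\<in>{1..n}. if e \<in> S then 1 else 0)"
    using Cons.prems sum.inter_restrict[of "{1..n}" "\<lambda>_. 1::nat" S]
    by (simp add: inf.absorb2 del: One_nat_def)
  moreover have "(\<Sum>e\<in>{1..n}. length (filter (\<lambda>S. e \<in> S) (S # B))) =
     (\<Sum>e\<in>{1..n}. (if e \<in> S then 1 else 0) + length (filter (\<lambda>S. e \<in> S) B))"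
    by (rule sum.cong) auto
  ultimately show ?case
    using Cons by (simp add: sum.distrib)
qed

lemma C_coeff_nonzero:
  assumes "C_coeff n k I \<noteq> 0"
  shows "sum_list I = k * n" "\<And>i. i \<in> set I \<Longrightarrow> i \<le> n"
proof -
  obtain B where "B \<in> restricted_partitions n k I"
    using assms unfolding C_coeff_def by (metis card.empty ex_in_conv)
  then have B: "map card B = I" "set B \<subseteq> Pow {1..n}"
    "\<forall>e\<in>{1..n}. length (filter (\<lambda>S. e \<in> S) B) = k"
    unfolding restricted_partitions_alt by auto
  show "sum_list I = k * n"
    using sum_list_map_card[OF B(2)] B(1,3) by simp
  show "i \<le> n" if i: "i \<in> set I" for i
  proof -
    obtain S where "S \<in> set B" "i = card S" using i B(1) by auto
    with B(2) show ?thesis using card_mono[of "{1..n}" S] by auto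
  qed
qed

text \<open>An empty block does not affect the multiplicities, so deleting the empty blocks is a
  bijection; its inverse puts them back at the zeros of \<open>I\<close>.\<close>

lemma C_coeff_filter: "C_coeff n k (filter (\<lambda>i. i \<noteq> 0) I) = C_coeff n k I"
proof -
  let ?F = "filter (\<lambda>S :: nat set. S \<noteq> {})"
  have inj: "B = B'"
    if "map card B = map card B'" "?F B = ?F B'" "set B \<subseteq> Pow {1..n}" "set B' \<subseteq> Pow {1..n}"
    for B B'
  proof -
    have "length B = length B'" using that(1) by (metis length_map)
    then show ?thesis using that
    proof (induction B B' rule: list_induct2)
      case (Cons x xs y ys)
      \<comment> \<open>Since \<open>card\<close> is 0 on infinite sets as well, finiteness is what
        makes block size 0 mean an empty block.\<close>
      then have "finite x" "finite y" by (auto intro: finite_subset)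
      then have "x = {} \<longleftrightarrow> y = {}" using Cons.prems(1) by (metis card_0_eq list.inject list.simps(9))
      then show ?case using Cons by (auto split: if_splits)
    qed simp
  qed
  have map_filter: "map card (?F B) = filter (\<lambda>i. i \<noteq> 0) (map card B)"
    if "set B \<subseteq> Pow {1..n}" for B
    using that
  proof (induction B)
    case (Cons S B)
    then have "finite S" by (auto intro: finite_subset)
    with Cons show ?case by auto
  qed simp
  have count: "length (filter (\<lambda>S. e \<in> S) (?F B)) = length (filter (\<lambda>S. e \<in> S) B)" for e B
    by (induction B) auto
  have surj: "\<exists>B. map card B = I \<and> set B \<subseteq> Pow {1..n} \<and> ?F B = B'"
    if "map card B' = filter (\<lambda>i. i \<noteq> 0) I" "set B' \<subseteq> Pow {1..n}" for B'
    using that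
  proof (induction I arbitrary: B')
    case (Cons i I)
    show ?case
    proof (cases "i = 0")
      case True
      with Cons obtain B where "map card B = I \<and> set B \<subseteq> Pow {1..n} \<and> ?F B = B'" by auto
      with True show ?thesis by (intro exI[of _ "{} # B"]) auto
    next
      case False
      with Cons.prems obtain S B'' where S: "B' = S # B''" "card S = i"
        "map card B'' = filter (\<lambda>i. i \<noteq> 0) I" by (cases B') auto
      with Cons obtain B where "map card B = I \<and> set B \<subseteq> Pow {1..n} \<and> ?F B = B''" by auto
      with S False Cons.prems show ?thesis by (intro exI[of _ "S # B"]) auto
    qed
  qed simp
  have "bij_betw ?F (restricted_partitions n k I) (restricted_partitions n k (filter (\<lambda>i. i \<noteq> 0) I))"
  proof (rule bij_betw_imageI)
    show "inj_on ?F (restricted_partitions n k I)"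
      unfolding restricted_partitions_alt by (rule inj_onI, rule inj) simp_all
    show "?F ` restricted_partitions n k I = restricted_partitions n k (filter (\<lambda>i. i \<noteq> 0) I)"
    proof (intro subset_antisym subsetI)
      fix B' assume "B' \<in> ?F ` restricted_partitions n k I"
      then show "B' \<in> restricted_partitions n k (filter (\<lambda>i. i \<noteq> 0) I)"
        unfolding restricted_partitions_alt using map_filter count by fastforce
    next
      fix B' assume B': "B' \<in> restricted_partitions n k (filter (\<lambda>i. i \<noteq> 0) I)"
      then obtain B where "map card B = I \<and> set B \<subseteq> Pow {1..n} \<and> ?F B = B'"
        using surj unfolding restricted_partitions_alt by auto
      with B' show "B' \<in> ?F ` restricted_partitions n k I"
        unfolding restricted_partitions_alt using count by (intro image_eqI[of _ _ B]) auto
    qed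
  qed
  then show ?thesis
    unfolding C_coeff_def by (simp add: bij_betw_same_card)
qed

text \<open>
  A restricted partition of \<open>{1^k, \<dots>, (n+1)^k}\<close> amounts to the choice of the \<open>k\<close> positions of the
  element \<open>n+1\<close> and a restricted partition of \<open>{1^k, \<dots>, n^k}\<close>, some of whose blocks may be empty.
\<close>

lemma C_coeff_Suc:
  assumes "0 \<notin> set J"
  shows "C_coeff (Suc n) k J = (\<Sum>t\<in>patterns k (length J). C_coeff n k (strip t J))"
proof -
  let ?dec = "\<lambda>t. map2 (\<lambda>b i. if b then i - 1 else i) t J"
  \<comment> \<open>\<open>?T\<close> records which blocks contain \<open>n+1\<close> and
    \<open>?R\<close> removes it from them; \<open>?add\<close> is the inverse of this pair.\<close>
  let ?T = "\<lambda>B. map (\<lambda>S :: nat set. Suc n \<in> S) B"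
  let ?R = "\<lambda>B. map (\<lambda>S :: nat set. S - {Suc n}) B"
  let ?add = "\<lambda>t B. map2 (\<lambda>b S. if b then insert (Suc n) S else S) t B"
  let ?D = "SIGMA t:patterns k (length J). restricted_partitions n k (?dec t)"
  have add_T_R: "?add (?T B) (?R B) = B" for B
    by (induction B) auto
  have T_add: "?T (?add t B) = t" and R_add: "?R (?add t B) = B"
    if "length t = length B" "set B \<subseteq> Pow {1..n}" for t B
    using that by (induction t B rule: list_induct2) auto
  have card_R: "map card (?R B) = map2 (\<lambda>b i. if b then i - 1 else i) (?T B) (map card B)"
    if "set B \<subseteq> Pow {1..Suc n}" for B
    using that by (induction B) (auto simp: card_Diff_singleton_if)
  have card_add: "map card (?add t B) = map2 (\<lambda>b i. if b then Suc i else i) t (map card B)"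
    if "length t = length B" "set B \<subseteq> Pow {1..n}" for t B
    using that
  proof (induction t B rule: list_induct2)
    case (Cons b t S B)
    then have "finite S" "Suc n \<notin> S" by (auto intro: finite_subset)
    with Cons show ?case by auto
  qed simp
  \<comment> \<open>Truncated subtraction is undone by \<open>Suc\<close> only at positive entries,
    hence the assumption on \<open>J\<close>.\<close>
  have inc_dec: "map2 (\<lambda>b i. if b then Suc i else i) t (?dec t) = J" if "length t = length J" for t
    using that assms by (induction t J rule: list_induct2) auto
  have count_R: "length (filter (\<lambda>S. e \<in> S) (?R B)) = length (filter (\<lambda>S. e \<in> S) B)"
    if "e \<in> {1..n}" for e B
    using that by (induction B) auto
  have count_T: "length (filter id (?T B)) = length (filter (\<lambda>S. Suc n \<in> S) B)" for B
    by (induction B) auto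
  have sub_R: "set (?R B) \<subseteq> Pow {1..n}" if "set B \<subseteq> Pow {1..Suc n}" for B
    using that by (fastforce simp: le_Suc_eq)
  have sub_add: "set (?add t B) \<subseteq> Pow {1..Suc n}" if "set B \<subseteq> Pow {1..n}" for t B
    using that by (induction t B rule: list_induct2') (auto simp: subset_eq le_Suc_eq)
  have Ball_Suc: "(\<forall>e\<in>{1..Suc n}. P e) \<longleftrightarrow> (\<forall>e\<in>{1..n}. P e) \<and> P (Suc n)" for P
    by (simp add: atLeastAtMostSuc_conv conj_commute)
  have "bij_betw (\<lambda>B. (?T B, ?R B)) (restricted_partitions (Suc n) k J) ?D"
  proof (rule bij_betw_byWitness[where f' = "\<lambda>(t, B). ?add t B"])
    show "\<forall>B\<in>restricted_partitions (Suc n) k J. (\<lambda>(t, B). ?add t B) (?T B, ?R B) = B"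
      using add_T_R by simp
    show "\<forall>p\<in>?D. (?T ((\<lambda>(t, B). ?add t B) p), ?R ((\<lambda>(t, B). ?add t B) p)) = p"
    proof
      fix p assume p: "p \<in> ?D"
      obtain t B where [simp]: "p = (t, B)" by force
      from p have *: "length t = length J" "map card B = ?dec t" "set B \<subseteq> Pow {1..n}"
        by (auto simp: patterns_def restricted_partitions_alt)
      have "length t = length B"
        using *(1) arg_cong[OF *(2), of length] by simp
      with *(3) show "(?T ((\<lambda>(t, B). ?add t B) p), ?R ((\<lambda>(t, B). ?add t B) p)) = p"
        using T_add R_add by simp
    qed
    show "(\<lambda>B. (?T B, ?R B)) ` restricted_partitions (Suc n) k J \<subseteq> ?D"
    proof
      fix p assume "p \<in> (\<lambda>B. (?T B, ?R B)) ` restricted_partitions (Suc n) k J"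
      then obtain B where p: "p = (?T B, ?R B)" and B: "map card B = J" "set B \<subseteq> Pow {1..Suc n}"
        "\<forall>e\<in>{1..Suc n}. length (filter (\<lambda>S. e \<in> S) B) = k"
        unfolding restricted_partitions_alt by blast
      have "?T B \<in> patterns k (length J)"
        using B count_T by (auto simp: patterns_def)
      moreover have "?R B \<in> restricted_partitions n k (?dec (?T B))"
        using B(3) count_R[of _ B] sub_R[OF B(2)] card_R[OF B(2)] unfolding B(1) Ball_Suc
        by (simp add: restricted_partitions_alt)
      ultimately show "p \<in> ?D" unfolding p by blast
    qed
    show "(\<lambda>(t, B). ?add t B) ` ?D \<subseteq> restricted_partitions (Suc n) k J"
    proof
      fix A assume "A \<in> (\<lambda>(t, B). ?add t B) ` ?D"
      then obtain t B where A: "A = ?add t B" and t: "length t = length J" "length (filter id t) = k"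
        and B: "map card B = ?dec t" "set B \<subseteq> Pow {1..n}"
        "\<forall>e\<in>{1..n}. length (filter (\<lambda>S. e \<in> S) B) = k"
        by (auto simp: patterns_def restricted_partitions_alt)
      have len: "length t = length B"
        using t(1) arg_cong[OF B(1), of length] by simp
      have "map card A = J"
        unfolding A card_add[OF len B(2)] B(1) by (rule inc_dec[OF t(1)])
      moreover have "length (filter (\<lambda>S. e \<in> S) A) = k" if "e \<in> {1..n}" for e
        using count_R[OF that, of A] B(3) that unfolding A R_add[OF len B(2)] by simp
      moreover have "length (filter (\<lambda>S. Suc n \<in> S) A) = k"
        using count_T[of A] t(2) unfolding A T_add[OF len B(2)] by simp
      ultimately show "A \<in> restricted_partitions (Suc n) k J"
        using sub_add[OF B(2), of t] unfolding restricted_partitions_alt Ball_Suc A by simp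
    qed
  qed
  then have "C_coeff (Suc n) k J = card ?D"
    unfolding C_coeff_def by (rule bij_betw_same_card)
  also have "\<dots> = (\<Sum>t\<in>patterns k (length J). C_coeff n k (?dec t))"
    by (simp add: finite_patterns finite_restricted_partitions C_coeff_def)
  also have "\<dots> = (\<Sum>t\<in>patterns k (length J). C_coeff n k (strip t J))"
    unfolding strip_def C_coeff_filter ..
  finally show ?thesis .
qed

section \<open>The stuffle product\<close>

lemma prepend_Nil [simp]: "prepend a f [] = 0"
  and prepend_Cons [simp]: "prepend a f (c # w) = (if c = a then f w else 0)"
  by (simp_all add: prepend_def)

lemma stuffle_Nil_right: "stuffle lam u [] w = (if w = u then 1 else 0)"
  by (cases u) auto

lemma stuffle_commute: "stuffle lam u v w = stuffle lam v u w"
proof (induction lam u v w rule: stuffle.induct)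
  case (3 lam a u b v w)
  then show ?case by (cases w) (auto simp: add.commute)
qed (auto simp: stuffle_Nil_right)

text \<open>The recursion read from the first letter of the result: it comes from \<open>I\<close>,
  is a new \<open>x\<close>, or is a letter of \<open>I\<close> merged with \<open>x\<close>. The
  cases absorb the two base clauses, so an induction on the result needs no separate treatment of
  empty factors.\<close>

lemma stuffle_ones_Cons:
  "stuffle lam I (replicate k 1) (c # J) =
    (case I of [] \<Rightarrow> 0 | a # u \<Rightarrow> if c = a then stuffle lam u (replicate k 1) J else 0) +
    (if k = 0 then 0
     else (if c = 1 then stuffle lam I (replicate (k - 1) 1) J else 0) +
       (case I of [] \<Rightarrow> 0
        | a # u \<Rightarrow> if c = a + 1 then lam * stuffle lam u (replicate (k - 1) 1) J else 0))"
  by (cases I; cases k) (auto simp: stuffle_Nil_right)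

lemma stuffle_ones_eq_0:
  "0 \<notin> set I \<Longrightarrow> 0 \<in> set J \<Longrightarrow> stuffle lam I (replicate k 1) J = 0"
proof (induction J arbitrary: I k)
  case (Cons c J)
  then show ?case
    by (auto simp: stuffle_ones_Cons simp del: One_nat_def replicate.simps stuffle.simps
        split: list.split)
qed simp

text \<open>Each way of producing \<open>J\<close> is a pattern \<open>t\<close> with
  \<open>strip t J = I\<close>. Every such way merges the same number of letters, because each of
  the \<open>k\<close> marks lengthens the word by one unless it merges; so one power of
  \<open>lam\<close> factors out.\<close>

lemma stuffle_ones:
  assumes "0 \<notin> set I" "0 \<notin> set J"
  shows "stuffle lam I (replicate k 1) J =
    lam ^ (k + length I - length J) *
      (\<Sum>t\<in>patterns k (length J). if strip t J = I then 1 else 0)"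
  using assms
proof (induction J arbitrary: I k)
  case Nil
  then show ?case
    by (cases I; cases k) (auto simp: patterns_0)
next
  case (Cons c J)
  define N where "N k I = (\<Sum>t\<in>patterns k (length J). if strip t J = I then 1 else 0 :: real)" for k I
  have IH: "stuffle lam I (replicate k 1) J = lam ^ (k + length I - length J) * N k I"
    if "0 \<notin> set I" for I k
    using Cons.IH[OF that] Cons.prems by (simp add: N_def)
  \<comment> \<open>Where the exponent would be truncated, no pattern exists. This lets
    \<open>lam_N\<close> raise the exponent by one without a side condition.\<close>
  have N_0: "N k I = 0" if "k + length I < length J" for k I
    using that Cons.prems length_le_strip[of _ k J] unfolding N_def
    by (intro sum.neutral) fastforce
  have lam_N: "lam * (lam ^ (k + length I - length J) * N k I) =
      lam ^ (Suc k + length I - length J) * N k I" for k I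
    using N_0[of k I] by (cases "k + length I < length J") (auto simp: Suc_diff_le)
  have N_Cons: "(\<Sum>t\<in>patterns k (length J). if c' # strip t J = I then 1 else 0) =
      (case I of [] \<Rightarrow> 0 | a # u \<Rightarrow> if c' = a then N k u else 0)" for c' k
    by (auto simp: N_def split: list.split)
  have "(\<Sum>t\<in>patterns k (length (c # J)). if strip t (c # J) = I then 1 else 0) =
      (case I of [] \<Rightarrow> 0 | a # u \<Rightarrow> if c = a then N k u else 0) +
      (if k = 0 then 0 else if c = 1 then N (k - 1) I
       else case I of [] \<Rightarrow> 0 | a # u \<Rightarrow> if c - 1 = a then N (k - 1) u else 0)"
    \<comment> \<open>A marked letter 1 can only be an insertion: a merge would need a letter 0 in
      \<open>I\<close>. So \<open>c = 1\<close> drops the letter instead of continuing with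
      0.\<close>
    using Cons.prems by (auto simp: sum_patterns_Suc strip_Cons N_Cons N_def[symmetric] simp del: One_nat_def)
  then show ?case
    using Cons.prems lam_N
    by (cases I; cases k)
      (auto simp: stuffle_ones_Cons IH algebra_simps
        simp del: replicate.simps stuffle.simps One_nat_def)
qed

section \<open>The product of coefficient functions\<close>

lemma word_mult_commute: "word_mult lam f g r = word_mult lam g f r"
  unfolding word_mult_def
  by (rule sum.reindex_bij_witness[where i = prod.swap and j = prod.swap])
    (auto simp: contributing_def stuffle_commute[of lam "snd (fst x)" for x] stuffle_commute add.commute)

lemma word_mult_diff_right:
  "word_mult lam f (\<lambda>p. g p - h p) r = word_mult lam f g r - word_mult lam f h r"
  unfolding word_mult_def sum_subtractf[symmetric]
  by (rule sum.cong) (auto simp: algebra_simps)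

text \<open>The right factor is a single word, so only the left word varies. \<open>U\<close> may
  exceed the support, which leaves room for an index set suited to exchanging sums.\<close>

lemma word_mult_of_word:
  assumes "finite U" "{u. stuffle lam u v w \<noteq> 0} \<subseteq> U"
  shows "word_mult lam f (of_word (0, v)) (c, w) = (\<Sum>u\<in>U. f (c, u) * stuffle lam u v w)"
proof -
  let ?S = "{u. stuffle lam u v w \<noteq> 0}"
  let ?g = "\<lambda>u. ((c, u), (0, v))"
  have "word_mult lam f (of_word (0, v)) (c, w) = (\<Sum>(p, q)\<in>?g ` ?S.
      f p * of_word (0, v) q * stuffle lam (snd p) (snd q) w)"
    unfolding word_mult_def snd_conv
    by (rule sum.mono_neutral_right[OF finite_contributing])
      (auto simp: contributing_def of_word_def image_iff)
  also have "\<dots> = (\<Sum>u\<in>?S. f (c, u) * stuffle lam u v w)"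
    by (subst sum.reindex) (auto intro!: inj_onI simp: of_word_def)
  also have "\<dots> = (\<Sum>u\<in>U. f (c, u) * stuffle lam u v w)"
    by (rule sum.mono_neutral_left) (use assms in auto)
  finally show ?thesis .
qed

lemma finite_stuffle_nonzero: "finite {u. stuffle lam u v w \<noteq> 0}"
proof (rule inj_on_finite)
  show "inj_on (\<lambda>u. ((0, u), (0, v))) {u. stuffle lam u v w \<noteq> 0}"
    by (auto intro: inj_onI)
  show "(\<lambda>u. ((0, u), (0, v))) ` {u. stuffle lam u v w \<noteq> 0} \<subseteq> contributing lam (0, w)"
    by (auto simp: contributing_def)
qed (rule finite_contributing)

lemma word_mult_one_right: "word_mult lam f (of_word (0, [])) = f"
proof
  fix r :: tword
  show "word_mult lam f (of_word (0, [])) r = f r"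
    using word_mult_of_word[of "{snd r}" lam "[]" "snd r" f "fst r"]
    by (auto simp: stuffle_Nil_right split: if_splits)
qed

section \<open>The powers of \<open>1 \<otimes> x^{\<otimes>k}\<close>\<close>

text \<open>The inner sum of the generating function as a coefficient function. Zero letters are
  excluded explicitly because \<open>C_coeff\<close> also counts empty blocks; letters above
  \<open>n\<close> and a wrong total degree already make \<open>C_coeff\<close> vanish.\<close>

definition power_coeff :: "real \<Rightarrow> nat \<Rightarrow> nat \<Rightarrow> tword \<Rightarrow> real" where
  "power_coeff lam k n p =
     (if fst p = 0 \<and> 0 \<notin> set (snd p)
      then real (C_coeff n k (snd p)) * lam ^ (k * n - length (snd p)) else 0)"

lemma length_le_sum_list: "0 \<notin> set I \<Longrightarrow> length I \<le> sum_list I" for I :: "nat list"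
  by (induction I) auto

lemma finite_sum_list_eq: "finite {I :: nat list. 0 \<notin> set I \<and> sum_list I = m}"
proof (rule finite_subset)
  show "{I. 0 \<notin> set I \<and> sum_list I = m} \<subseteq> {I. set I \<subseteq> {..m} \<and> length I \<le> m}"
    using length_le_sum_list member_le_sum_list by fastforce
qed (rule finite_lists_length_le, simp)

lemma power_coeff_nonzero:
  assumes "power_coeff lam k n p \<noteq> 0"
  shows "fst p = 0" "0 \<notin> set (snd p)" "sum_list (snd p) = k * n" "snd p \<in> bounded_compositions n k"
    "lam = 0 \<Longrightarrow> length (snd p) = k * n"
proof -
  show *: "fst p = 0" "0 \<notin> set (snd p)"
    using assms by (auto simp: power_coeff_def split: if_splits)
  have "C_coeff n k (snd p) \<noteq> 0" "lam ^ (k * n - length (snd p)) \<noteq> 0"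
    using assms by (auto simp: power_coeff_def split: if_splits)
  note ** = C_coeff_nonzero[OF this(1)] this(2)
  then show "sum_list (snd p) = k * n" by simp
  show "snd p \<in> bounded_compositions n k"
    using ** * by (auto simp: bounded_compositions_def Suc_le_eq intro: gr0I)
  show "length (snd p) = k * n" if "lam = 0"
    using **(3) that length_le_sum_list[OF *(2)] **(1) by (auto simp: power_0_left split: if_splits)
qed

lemma finite_bounded_compositions: "finite (bounded_compositions n k)"
  by (rule finite_subset[OF _ finite_sum_list_eq[of "k * n"]])
    (auto simp: bounded_compositions_def)

lemma finite_power_coeff: "finite {p. power_coeff lam k n p \<noteq> 0}"
proof (rule finite_subset)
  show "{p. power_coeff lam k n p \<noteq> 0} \<subseteq> {0} \<times> bounded_compositions n k"
    using power_coeff_nonzero(1,4) by force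
qed (simp add: finite_bounded_compositions)

lemma power_coeff_0: "power_coeff lam k 0 = of_word (0, [])"
proof
  fix p :: tword
  have "C_coeff 0 k [] = 1"
    by (simp add: C_coeff_def restricted_partitions_alt cong: conj_cong)
  moreover have "power_coeff lam k 0 p = 0" if "p \<noteq> (0, [])"
  proof (rule ccontr)
    assume "\<not> ?thesis"
    note * = power_coeff_nonzero(1-3)[OF this]
    then have "snd p = []" using length_le_sum_list[of "snd p"] by (simp del: sum_list_eq_0_iff)
    with * that show False by (simp add: prod_eq_iff)
  qed
  ultimately show "power_coeff lam k 0 p = of_word (0, []) p"
    by (auto simp: of_word_def power_coeff_def)
qed

text \<open>Both \<open>stuffle_ones\<close> and \<open>C_coeff_Suc\<close> are sums over the
  patterns of \<open>J\<close>, so the claim follows by exchanging the sums over \<open>u\<close>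
  and \<open>t\<close>. The exponents \<open>k * n - length u\<close> and
  \<open>k + length u - length J\<close> add up to \<open>k * Suc n - length J\<close>.\<close>

lemma power_coeff_Suc:
  "word_mult lam (power_coeff lam k n) (one_tensor_x k) = power_coeff lam k (Suc n)"
proof
  fix r :: tword
  obtain c J where r: "r = (c, J)" by force
  let ?st = "\<lambda>u. stuffle lam u (replicate k 1) J"
  let ?P = "patterns k (length J)"
  \<comment> \<open>For \<open>lam = 0\<close> a stripped word may lie outside the support of the
    stuffle product, yet it has to be an index for the exchange of sums.\<close>
  define U where "U = {u. ?st u \<noteq> 0} \<union> (\<lambda>t. strip t J) ` ?P"
  have U: "finite U"
    by (simp add: U_def finite_stuffle_nonzero finite_patterns del: One_nat_def)
  have in_U: "strip t J \<in> U" if "t \<in> ?P" for t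
    using that by (simp add: U_def)
  have "word_mult lam (power_coeff lam k n) (one_tensor_x k) r =
      (\<Sum>u\<in>U. power_coeff lam k n (c, u) * ?st u)"
    unfolding r one_tensor_x_def one_tensor_def
    by (rule word_mult_of_word[OF U]) (auto simp: U_def)
  also have "\<dots> = power_coeff lam k (Suc n) r"
  proof (cases "c = 0 \<and> 0 \<notin> set J")
    case False
    then have "power_coeff lam k n (c, u) * ?st u = 0" for u
      using stuffle_ones_eq_0[of u J lam k] by (auto simp: power_coeff_def simp del: One_nat_def)
    then have "(\<Sum>u\<in>U. power_coeff lam k n (c, u) * ?st u) = 0" by (intro sum.neutral) blast
    with False show ?thesis by (auto simp: r power_coeff_def[of _ _ "Suc n"])
  next
    case True
    have "power_coeff lam k n (c, u) * ?st u =
       (\<Sum>t\<in>?P. if strip t J = u then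
          real (C_coeff n k (strip t J)) * lam ^ (k * Suc n - length J) else 0)" for u
    proof (cases "power_coeff lam k n (c, u) = 0")
      case zero: True
      \<comment> \<open>If the coefficient is zero although \<open>C_coeff\<close> is not, then
        \<open>lam = 0\<close> with a positive exponent. The exponent belonging to \<open>J\<close>
        is at least as large, so that power vanishes too.\<close>
      have vanish: "real (C_coeff n k u) * lam ^ (k * Suc n - length J) = 0"
        if "t \<in> ?P" "strip t J = u" for t
      proof (cases "C_coeff n k u = 0")
        case False
        then have *: "sum_list u = k * n" by (rule C_coeff_nonzero)
        have "0 \<notin> set u" using zero_notin_strip that(2) by blast
        with zero True False have "lam = 0" "k * n - length u \<noteq> 0"
          by (auto simp: power_coeff_def)
        moreover have "length J \<le> k + length u"
          using length_le_strip[OF that(1)] True that(2) by simp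
        ultimately show ?thesis by (simp add: power_0_left)
      qed simp
      show ?thesis
        unfolding zero mult_zero_left
        by (rule sum.neutral[symmetric]) (use vanish in \<open>auto simp del: mult_eq_0_iff\<close>)
    next
      case False
      note u = power_coeff_nonzero[OF False, simplified]
      have exponent: "lam ^ (k * n - length u) * lam ^ (k + length u - length J) =
          lam ^ (k * Suc n - length J)" if "t \<in> ?P" "strip t J = u" for t
      proof -
        have "length J \<le> k + length u" "length u \<le> k * n"
          using length_le_strip[OF that(1)] True that(2) length_le_sum_list[OF u(2)] u(3) by auto
        then show ?thesis by (simp add: add.commute flip: power_add)
      qed
      have "power_coeff lam k n (c, u) * ?st u =
        (\<Sum>t\<in>?P. real (C_coeff n k u) * lam ^ (k * n - length u) *
          (lam ^ (k + length u - length J) * (if strip t J = u then 1 else 0)))"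
        using u True by (simp add: power_coeff_def stuffle_ones sum_distrib_left del: One_nat_def)
      also have "\<dots> = (\<Sum>t\<in>?P. if strip t J = u then
          real (C_coeff n k (strip t J)) * lam ^ (k * Suc n - length J) else 0)"
      proof (rule sum.cong)
        fix t assume t: "t \<in> ?P"
        show "real (C_coeff n k u) * lam ^ (k * n - length u) *
            (lam ^ (k + length u - length J) * (if strip t J = u then 1 else 0)) =
          (if strip t J = u then
            real (C_coeff n k (strip t J)) * lam ^ (k * Suc n - length J) else 0)"
          using exponent[OF t] by (simp add: mult.assoc del: mult_Suc_right)
      qed simp
      finally show ?thesis .
    qed
    then have "(\<Sum>u\<in>U. power_coeff lam k n (c, u) * ?st u) =
        (\<Sum>u\<in>U. \<Sum>t\<in>?P. if strip t J = u then
          real (C_coeff n k (strip t J)) * lam ^ (k * Suc n - length J) else 0)"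
      by (simp del: One_nat_def)
    also have "\<dots> = (\<Sum>t\<in>?P. \<Sum>u\<in>U. if strip t J = u then
          real (C_coeff n k (strip t J)) * lam ^ (k * Suc n - length J) else 0)"
      by (rule sum.swap)
    also have "\<dots> = (\<Sum>t\<in>?P. real (C_coeff n k (strip t J)) * lam ^ (k * Suc n - length J))"
      by (rule sum.cong) (simp_all add: U in_U del: mult_Suc_right)
    also have "\<dots> = power_coeff lam k (Suc n) r"
      using True by (simp add: r power_coeff_def C_coeff_Suc flip: sum_distrib_right)
    finally show ?thesis .
  qed
  finally show "word_mult lam (power_coeff lam k n) (one_tensor_x k) r = power_coeff lam k (Suc n) r" .
qed

section \<open>The geometric series\<close>

text \<open>The candidate inverse. For \<open>k \<ge> 1\<close> the cutoff loses nothing: the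
  \<open>n\<close>-th power lives in degree \<open>k * n\<close>, which is at least
  \<open>n\<close>.\<close>

definition geometric :: "real \<Rightarrow> nat \<Rightarrow> tword \<Rightarrow> real" where
  "geometric lam k p = (\<Sum>n\<le>x_degree p. power_coeff lam k n p)"

lemma power_coeff_x_degree: "power_coeff lam k n p \<noteq> 0 \<Longrightarrow> x_degree p = k * n"
  using power_coeff_nonzero[of lam k n p] by (simp add: x_degree_def)

text \<open>The vanishing hypothesis is left abstract so that it can be met by a degree bound in
  \<open>bihatSh\<close> and by a length bound in \<open>hatSh\<close>.\<close>

lemma geometric_eq:
  assumes "k \<ge> 1" "\<And>n. n \<ge> N \<Longrightarrow> power_coeff lam k n p = 0"
  shows "geometric lam k p = (\<Sum>n<N. power_coeff lam k n p)"
proof -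
  have "n \<le> x_degree p" if "power_coeff lam k n p \<noteq> 0" for n
    using power_coeff_x_degree[OF that] assms(1) by simp
  then have "(\<Sum>n\<le>x_degree p. power_coeff lam k n p) =
     (\<Sum>n\<in>{..x_degree p} \<union> {..<N}. power_coeff lam k n p)"
    by (intro sum.mono_neutral_left) auto
  also have "\<dots> = (\<Sum>n<N. power_coeff lam k n p)"
    using assms(2) by (intro sum.mono_neutral_right) (auto simp: not_less)
  finally show ?thesis by (simp add: geometric_def)
qed

lemma geometric_eq_degree:
  assumes "k \<ge> 1" "x_degree p < N"
  shows "geometric lam k p = (\<Sum>n<N. power_coeff lam k n p)"
proof (rule geometric_eq[OF assms(1)])
  fix n assume "N \<le> n"
  then have "x_degree p < k * n"
    using assms by (metis less_le_trans mult_le_mono1 nat_mult_1)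
  then show "power_coeff lam k n p = 0"
    using power_coeff_x_degree[of lam k n p] by auto
qed

lemma word_mult_geometric:
  assumes "k \<ge> 1"
  shows "word_mult lam (geometric lam k) (one_tensor_x k) r =
    geometric lam k r - of_word (0, []) r"
proof -
  \<comment> \<open>Left factors contributing to \<open>r\<close> have degree at most that of
    \<open>r\<close>, so one cutoff serves all of them and the sums can be exchanged.\<close>
  define N where "N = Suc (x_degree r)"
  have "geometric lam k p = (\<Sum>n<N. power_coeff lam k n p)" if "(p, q) \<in> contributing lam r" for p q
  proof (rule geometric_eq_degree[OF assms])
    show "x_degree p < N"
      using that stuffle_nonzero[of lam "snd p" "snd q" "snd r"]
      by (auto simp: contributing_def x_degree_def N_def)
  qed
  then have "word_mult lam (geometric lam k) (one_tensor_x k) r =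
     (\<Sum>(p, q)\<in>contributing lam r. \<Sum>n<N.
        power_coeff lam k n p * one_tensor_x k q * stuffle lam (snd p) (snd q) (snd r))"
    unfolding word_mult_def by (intro sum.cong) (auto simp: sum_distrib_right)
  also have "\<dots> = (\<Sum>n<N. word_mult lam (power_coeff lam k n) (one_tensor_x k) r)"
    unfolding word_mult_def case_prod_unfold by (rule sum.swap)
  \<comment> \<open>Multiplication shifts the index by one; adding and subtracting the term for 0
    restores a full partial sum.\<close>
  also have "\<dots> = (\<Sum>n<Suc N. power_coeff lam k n r) - power_coeff lam k 0 r"
    unfolding power_coeff_Suc sum.lessThan_Suc_shift by simp
  also have "\<dots> = geometric lam k r - of_word (0, []) r"
    using geometric_eq_degree[OF assms, of r "Suc N" lam] by (simp add: N_def power_coeff_0)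
  finally show ?thesis .
qed

text \<open>Multiplication by \<open>1 \<otimes> x^{\<otimes>k}\<close> raises the degree, so it has no nonzero fixed point.\<close>

lemma word_mult_one_tensor_x_fixed:
  assumes "k \<ge> 1" "\<And>r. word_mult lam g (one_tensor_x k) r = g r"
  shows "g r = 0"
proof (induction "x_degree r" arbitrary: r rule: less_induct)
  case less
  have "g p * one_tensor_x k q * stuffle lam (snd p) (snd q) (snd r) = 0"
    if "(p, q) \<in> contributing lam r" for p q
  proof (cases "one_tensor_x k q = 0")
    case False
    then have "q = (0, replicate k 1)"
      by (auto simp: one_tensor_x_def one_tensor_def of_word_def split: if_splits)
    then have "x_degree p < x_degree r"
      using that assms(1) stuffle_nonzero[of lam "snd p" "snd q" "snd r"]
      by (auto simp: contributing_def x_degree_def sum_list_replicate)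
    then show ?thesis using less by simp
  qed simp
  then have "word_mult lam g (one_tensor_x k) r = 0"
    unfolding word_mult_def by (intro sum.neutral) auto
  with assms(2) show ?case by simp
qed

section \<open>The complete algebras\<close>

text \<open>Treats the three coefficient spaces at once. Only the linear structure depends on
  \<open>M\<close>; \<open>word_mult\<close> is the same function throughout, and the products that
  occur are computed explicitly.\<close>

locale word_space =
  fixes M :: "(tword \<Rightarrow> real) set" and lam :: real
  assumes finite_support: "finite {p. f p \<noteq> 0} \<Longrightarrow> f \<in> M"
    and add_closed: "f \<in> M \<Longrightarrow> g \<in> M \<Longrightarrow> (\<lambda>p. f p + g p) \<in> M"
    and smult_closed: "f \<in> M \<Longrightarrow> (\<lambda>p. c * f p) \<in> M"
begin

abbreviation R where "R \<equiv> word_algebra lam M"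

lemma word_algebra_simps:
  "carrier R = M" "mult R = word_mult lam" "one R = of_word (0, [])" "zero R = (\<lambda>_. 0)"
  "add R = (\<lambda>f g p. f p + g p)" "smult R = (\<lambda>c f p. c * f p)"
  by (simp_all add: word_algebra_def)

lemma zero_closed: "(\<lambda>_. 0) \<in> M"
  by (rule finite_support) simp

lemma of_word_closed: "of_word p \<in> M"
  by (rule finite_support) (simp add: of_word_def)

lemma power_coeff_closed: "power_coeff lam k n \<in> M"
  by (rule finite_support) (rule finite_power_coeff)

lemma abelian_group: "abelian_group R"
proof (rule abelian_groupI)
  fix f assume "f \<in> carrier R"
  then have "(\<lambda>p. - f p) \<in> M" using smult_closed[of f "-1"] by (simp add: word_algebra_simps)
  then show "\<exists>g\<in>carrier R. g \<oplus>\<^bsub>R\<^esub> f = \<zero>\<^bsub>R\<^esub>"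
    by (intro bexI[of _ "\<lambda>p. - f p"]) (auto simp: word_algebra_simps)
qed (auto simp: word_algebra_simps add_closed zero_closed algebra_simps)

interpretation abelian_group R by (rule abelian_group)

lemma minus_eq:
  assumes "f \<in> M" "g \<in> M"
  shows "f \<ominus>\<^bsub>R\<^esub> g = (\<lambda>p. f p - g p)"
proof -
  have g: "(\<lambda>p. - g p) \<in> M" using smult_closed[OF assms(2), of "-1"] by simp
  have "\<ominus>\<^bsub>R\<^esub> g = (\<lambda>p. - g p)"
    by (rule minus_equality) (use assms g in \<open>auto simp: word_algebra_simps\<close>)
  then show ?thesis by (simp add: a_minus_def word_algebra_simps)
qed

lemma finsum_eq: "finite A \<Longrightarrow> (\<And>i. i \<in> A \<Longrightarrow> s i \<in> M) \<Longrightarrow>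
    (\<Oplus>\<^bsub>R\<^esub>i\<in>A. s i) = (\<lambda>p. \<Sum>i\<in>A. s i p)"
proof (induction A rule: finite_induct)
  case empty
  then show ?case by (simp add: word_algebra_simps)
next
  case (insert x F)
  then show ?case by (subst finsum_insert) (auto simp: word_algebra_simps)
qed

lemma pow_eq: "one_tensor_x k [^]\<^bsub>R\<^esub> n = power_coeff lam k n"
  by (induction n) (simp_all add: word_algebra_simps power_coeff_0 power_coeff_Suc)

text \<open>At a word with leading exponent 0 only the composition equal to its tail contributes,
  and outside \<open>bounded_compositions\<close> both sides vanish.\<close>

lemma composition_sum_eq: "composition_sum R lam k n = power_coeff lam k n"
proof
  fix p :: tword
  let ?c = "\<lambda>I. real (C_coeff n k I) * lam ^ (k * n - length I)"
  have "composition_sum R lam k n p =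
     (\<Sum>I\<in>bounded_compositions n k. ?c I * one_tensor I p)"
    unfolding composition_sum_def
    by (subst finsum_eq)
      (auto simp: finite_bounded_compositions word_algebra_simps one_tensor_def
        intro: smult_closed of_word_closed)
  also have "\<dots> = (\<Sum>I\<in>bounded_compositions n k. if I = snd p then (if fst p = 0 then ?c I else 0) else 0)"
    by (rule sum.cong) (auto simp: one_tensor_def of_word_def prod_eq_iff)
  also have "\<dots> = (if snd p \<in> bounded_compositions n k \<and> fst p = 0 then ?c (snd p) else 0)"
    by (simp add: finite_bounded_compositions)
  also have "\<dots> = power_coeff lam k n p"
  proof (cases "power_coeff lam k n p = 0")
    case True
    moreover have "0 \<notin> set (snd p)" if "snd p \<in> bounded_compositions n k"
      using that by (force simp: bounded_compositions_def)
    ultimately show ?thesis by (auto simp: power_coeff_def split: if_splits)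
  next
    case False
    then show ?thesis
      using power_coeff_nonzero[OF False] by (simp add: power_coeff_def)
  qed
  finally show "composition_sum R lam k n p = power_coeff lam k n p" .
qed

lemma geometric_inverse:
  assumes "k \<ge> 1" "geometric lam k \<in> M"
  defines "d \<equiv> \<one>\<^bsub>R\<^esub> \<ominus>\<^bsub>R\<^esub> one_tensor_x k"
  shows "d \<in> Units R" "inv\<^bsub>R\<^esub> d = geometric lam k"
proof -
  have X: "one_tensor_x k \<in> M"
    by (simp add: one_tensor_x_def one_tensor_def of_word_closed)
  have d: "d = (\<lambda>p. of_word (0, []) p - one_tensor_x k p)"
    unfolding d_def word_algebra_simps by (rule minus_eq[OF of_word_closed X])
  have d_M: "d \<in> M"
    unfolding d using add_closed[OF of_word_closed smult_closed[OF X, of "-1"]] by simp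
  have mult_d: "word_mult lam f d r = f r - word_mult lam f (one_tensor_x k) r" for f r
    unfolding d word_mult_diff_right word_mult_one_right ..
  have commute: "word_mult lam f g = word_mult lam g f" for f g
    using word_mult_commute by blast
  have inverse: "word_mult lam (geometric lam k) d = of_word (0, [])"
    by (rule ext) (simp add: mult_d word_mult_geometric[OF assms(1)])
  \<comment> \<open>\<open>inv\<close> is a definite description, so uniqueness is required. The
    difference of two inverses is annihilated by \<open>d\<close>, that is, fixed under
    multiplication by \<open>one_tensor_x k\<close>, hence zero.\<close>
  have unique: "y = geometric lam k" if "word_mult lam y d = of_word (0, [])" for y
  proof
    fix r
    have "word_mult lam (\<lambda>p. y p - geometric lam k p) (one_tensor_x k) r =
        y r - geometric lam k r" for r
      using fun_cong[OF that, of r] fun_cong[OF inverse, of r]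
      unfolding commute[of _ "one_tensor_x k"] word_mult_diff_right
      by (simp add: mult_d commute[of _ "one_tensor_x k"])
    from word_mult_one_tensor_x_fixed[OF assms(1) this] show "y r = geometric lam k r" by simp
  qed
  have inverse': "word_mult lam d (geometric lam k) = of_word (0, [])"
    using inverse by (simp only: commute[of d])
  show "d \<in> Units R"
    using assms(2) d_M inverse inverse' unfolding Units_def word_algebra_simps by blast
  show "inv\<^bsub>R\<^esub> d = geometric lam k"
    unfolding m_inv_def word_algebra_simps
    by (rule the_equality) (use assms(2) inverse inverse' unique in blast)+
qed

lemma series_sums_geometric:
  assumes "geometric lam k \<in> M"
    and "\<And>j N. N \<ge> j \<Longrightarrow> (\<lambda>p. (\<Sum>n<N. power_coeff lam k n p) - geometric lam k p) \<in> F j"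
  shows "series_sums R F (power_coeff lam k) (geometric lam k)"
  unfolding series_sums_def
proof
  fix j
  have "(\<Oplus>\<^bsub>R\<^esub>n\<in>{..<N}. power_coeff lam k n) \<ominus>\<^bsub>R\<^esub> geometric lam k \<in> F j" if "N \<ge> j" for N
  proof -
    have "(\<Oplus>\<^bsub>R\<^esub>n\<in>{..<N}. power_coeff lam k n) \<in> M"
      using finsum_closed[of "power_coeff lam k"] power_coeff_closed
      by (simp add: word_algebra_simps)
    then show ?thesis
      using assms(2)[OF that]
      by (subst minus_eq[OF _ assms(1)]) (simp_all add: finsum_eq power_coeff_closed)
  qed
  then show "\<forall>\<^sub>F N in sequentially.
      (\<Oplus>\<^bsub>R\<^esub>n\<in>{..<N}. power_coeff lam k n) \<ominus>\<^bsub>R\<^esub> geometric lam k \<in> F j"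
    by (auto simp: eventually_sequentially)
qed

text \<open>Isolates what depends on the algebra: the geometric series must lie in \<open>M\<close>,
  and its tails must lie in the given filtration.\<close>

lemma generating_function:
  assumes "k \<ge> 1" "geometric lam k \<in> M"
    and "\<And>j N. N \<ge> j \<Longrightarrow> (\<lambda>p. (\<Sum>n<N. power_coeff lam k n p) - geometric lam k p) \<in> F j"
  shows "let d = \<one>\<^bsub>R\<^esub> \<ominus>\<^bsub>R\<^esub> one_tensor_x k
    in d \<in> Units R
       \<and> series_sums R F (\<lambda>n. one_tensor_x k [^]\<^bsub>R\<^esub> n) (inv\<^bsub>R\<^esub> d)
       \<and> series_sums R F (\<lambda>n. composition_sum R lam k n) (inv\<^bsub>R\<^esub> d)"
  unfolding Let_def pow_eq composition_sum_eq geometric_inverse(2)[OF assms(1,2)]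
  using geometric_inverse(1)[OF assms(1,2)] series_sums_geometric[OF assms(2), of F] assms(3)
  by blast

end

section \<open>The concrete coefficient spaces, with invertibility and convergence in the
  completions\<close>

lemma word_space_finite: "word_space {f. finite {p. f p \<noteq> 0}}"
proof
  fix f g :: "tword \<Rightarrow> real" and c :: real
  assume f: "f \<in> {f. finite {p. f p \<noteq> 0}}"
  show "(\<lambda>p. c * f p) \<in> {f. finite {p. f p \<noteq> 0}}"
    using f by (auto elim: rev_finite_subset)
  assume "g \<in> {f. finite {p. f p \<noteq> 0}}"
  with f have "finite ({p. f p \<noteq> 0} \<union> {p. g p \<noteq> 0})" by simp
  then have "finite {p. f p + g p \<noteq> 0}" by (rule rev_finite_subset) auto
  then show "(\<lambda>p. f p + g p) \<in> {f. finite {p. f p \<noteq> 0}}" by simp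
qed simp

lemma word_space_finite_length: "word_space {f. \<forall>i. finite {p. tensor_len p = i \<and> f p \<noteq> 0}}"
proof
  fix f g :: "tword \<Rightarrow> real" and c :: real
  assume f: "f \<in> {f. \<forall>i. finite {p. tensor_len p = i \<and> f p \<noteq> 0}}"
  show "(\<lambda>p. c * f p) \<in> {f. \<forall>i. finite {p. tensor_len p = i \<and> f p \<noteq> 0}}"
    using f by (auto elim: rev_finite_subset)
  assume g: "g \<in> {f. \<forall>i. finite {p. tensor_len p = i \<and> f p \<noteq> 0}}"
  have "finite {p. tensor_len p = i \<and> f p + g p \<noteq> 0}" for i
    by (rule finite_subset[of _ "{p. tensor_len p = i \<and> f p \<noteq> 0} \<union> {p. tensor_len p = i \<and> g p \<noteq> 0}"])
      (use f g in auto)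
  then show "(\<lambda>p. f p + g p) \<in> {f. \<forall>i. finite {p. tensor_len p = i \<and> f p \<noteq> 0}}"
    by blast
qed (auto elim: rev_finite_subset)

lemma word_space_UNIV: "word_space UNIV"
  by standard auto

text \<open>In weight 0 nothing merges: length and letter sum are both \<open>k * n\<close>, so
  positive letters must all be 1. Thus each tensor length carries at most one word, which places the
  series in \<open>hatSh\<close>.\<close>

lemma geometric_0_nonzero:
  assumes "geometric 0 k p \<noteq> 0"
  shows "p = (0, replicate (length (snd p)) 1)"
proof -
  have "\<exists>n. power_coeff 0 k n p \<noteq> 0"
    using assms by (auto simp: geometric_def dest: sum.not_neutral_contains_not_neutral)
  then obtain n where "power_coeff 0 k n p \<noteq> 0" ..
  note * = power_coeff_nonzero[OF this]
  have "I = replicate (length I) 1" if "0 \<notin> set I" "sum_list I = length I" for I :: "nat list"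
    using that
  proof (induction I)
    case (Cons i I)
    then have "length I \<le> sum_list I" by (intro length_le_sum_list) simp
    with Cons show ?case by auto
  qed simp
  from this[of "snd p"] * show ?thesis by (simp add: prod_eq_iff)
qed

theorem theorem4p5:
  fixes lam :: real and k :: nat
  assumes "k \<ge> 1"
  shows
    "(\<forall>n. one_tensor_x k [^]\<^bsub>Sh lam\<^esub> n = composition_sum (Sh lam) lam k n)
     \<and> (let R = bihatSh lam; d = \<one>\<^bsub>R\<^esub> \<ominus>\<^bsub>R\<^esub> one_tensor_x k
        in d \<in> Units R
           \<and> series_sums R bihatFil (\<lambda>n. one_tensor_x k [^]\<^bsub>R\<^esub> n) (inv\<^bsub>R\<^esub> d)
           \<and> series_sums R bihatFil (\<lambda>n. composition_sum R lam k n) (inv\<^bsub>R\<^esub> d))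
     \<and> (lam = 0 \<longrightarrow>
        (let R = hatSh lam; d = \<one>\<^bsub>R\<^esub> \<ominus>\<^bsub>R\<^esub> one_tensor_x k
         in d \<in> Units R
            \<and> series_sums R hatFil (\<lambda>n. one_tensor_x k [^]\<^bsub>R\<^esub> n) (inv\<^bsub>R\<^esub> d)
            \<and> series_sums R hatFil (\<lambda>n. composition_sum R lam k n) (inv\<^bsub>R\<^esub> d)))"
proof (intro conjI allI impI)
  fix n
  interpret word_space "{f. finite {p. f p \<noteq> 0}}" lam by (rule word_space_finite)
  show "one_tensor_x k [^]\<^bsub>Sh lam\<^esub> n = composition_sum (Sh lam) lam k n"
    unfolding Sh_def pow_eq composition_sum_eq ..
next
  interpret word_space UNIV lam by (rule word_space_UNIV)
  \<comment> \<open>A word of degree below \<open>j \<le> N\<close> already has its final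
    coefficient in the \<open>N\<close>-th partial sum.\<close>
  have "(\<lambda>p. (\<Sum>n<N. power_coeff lam k n p) - geometric lam k p) \<in> bihatFil j" if "N \<ge> j" for j N
    using that by (simp add: bihatFil_def geometric_eq_degree[OF assms, where N = N])
  then show "let R = bihatSh lam; d = \<one>\<^bsub>R\<^esub> \<ominus>\<^bsub>R\<^esub> one_tensor_x k
        in d \<in> Units R
           \<and> series_sums R bihatFil (\<lambda>n. one_tensor_x k [^]\<^bsub>R\<^esub> n) (inv\<^bsub>R\<^esub> d)
           \<and> series_sums R bihatFil (\<lambda>n. composition_sum R lam k n) (inv\<^bsub>R\<^esub> d)"
    unfolding bihatSh_def Let_def[of "word_algebra lam UNIV"]
    by (intro generating_function assms) simp_all
next
  assume lam: "lam = 0"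
  interpret word_space "{f. \<forall>i. finite {p. tensor_len p = i \<and> f p \<noteq> 0}}" lam
    by (rule word_space_finite_length)
  have closed: "geometric lam k \<in> {f. \<forall>i. finite {p. tensor_len p = i \<and> f p \<noteq> 0}}"
  proof (intro CollectI allI)
    fix i
    show "finite {p. tensor_len p = i \<and> geometric lam k p \<noteq> 0}"
    proof (rule finite_subset)
      \<comment> \<open>The \<open>i - 1\<close> discounts the leading tensor factor, which
        \<open>tensor_len\<close> includes.\<close>
      show "{p. tensor_len p = i \<and> geometric lam k p \<noteq> 0} \<subseteq> {(0, replicate (i - 1) 1)}"
        using geometric_0_nonzero[of k] by (fastforce simp: lam tensor_len_def)
    qed simp
  qed
  have "(\<lambda>p. (\<Sum>n<N. power_coeff lam k n p) - geometric lam k p) \<in> hatFil j" if "N \<ge> j" for j N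
  proof -
    \<comment> \<open>In weight 0 the \<open>n\<close>-th power has words of length
      \<open>k * n \<ge> n\<close> only, so powers from \<open>N \<ge> j\<close> on lie in tensor
      length above \<open>j\<close>.\<close>
    have "(\<Sum>n<N. power_coeff lam k n p) = geometric lam k p" if p: "tensor_len p < j" for p
    proof (rule geometric_eq[OF assms, symmetric], rule ccontr)
      fix n assume n: "N \<le> n" "power_coeff lam k n p \<noteq> 0"
      then have "length (snd p) = k * n" using power_coeff_nonzero(5) lam by blast
      moreover have "1 * n \<le> k * n" using assms by (rule mult_le_mono1)
      ultimately show False using p \<open>N \<ge> j\<close> n(1) unfolding tensor_len_def by linarith
    qed
    then show ?thesis by (simp add: hatFil_def)
  qed
  then show "let R = hatSh lam; d = \<one>\<^bsub>R\<^esub> \<ominus>\<^bsub>R\<^esub> one_tensor_x k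
         in d \<in> Units R
            \<and> series_sums R hatFil (\<lambda>n. one_tensor_x k [^]\<^bsub>R\<^esub> n) (inv\<^bsub>R\<^esub> d)
            \<and> series_sums R hatFil (\<lambda>n. composition_sum R lam k n) (inv\<^bsub>R\<^esub> d)"
    unfolding hatSh_def Let_def[of "word_algebra lam M" for M]
    by (intro generating_function assms closed)
qed

end
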